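(* Let $G=(V,E)$ be a finite graph on $N\ge2$ vertices, with eigenvalues $0=\lambda_1<\lambda_2\le\dots\le\lambda_N$, and let $D:=\max_{x,y\in V}d(x,y)$ be its diameter. Let $K\ge0$ and suppose $G$ satisfies the exponential curvature dimension inequality $CDE(n,-K)$. Let $\epsilon>0$, $0<\gamma\le1$, $\beta>0$, and let $C_1,C_2$ (depending only on $n,\epsilon,\beta,\gamma,D_m,m_{\max},\mu_{\min}$) be the constants, together with $C_3=C_3(\gamma,\beta,D_m)>0$, in the heat kernel estimate $$p_t(x,y)\le C_1\,\frac{\exp(-(1-\gamma)\mu t)}{\sqrt{m(B_x(\sqrt t))\,m(B_y(\sqrt t))}}\exp\left(-\frac{C_3\,d^2(x,y)}{4(1+2\epsilon)t}+C_2\sqrt{Knt}\right)\qquad (x,y\in V,\ t\ge\max\{\beta d(x,y),1\}),$$ valid for all graphs satisfying $CDE(n,-K)$. Then for all $x,y\in V$ and all $t\ge D^2$, $$\left|p_t(x,y)-\frac1{m(V)}\right|\le\frac1{m(V)}\left(C_1\exp\bigl(C_2\sqrt{Kn}\,D\bigr)-1\right)\exp(\lambda_2D^2-\lambda_2t).$$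
   Context: Graphs: $G=(V,E)$ is a connected graph, locally finite (possibly infinite in the quoted heat kernel estimate), with a symmetric weight $\mu_{\cdot\cdot}:V\times V\to[0,\infty)$, $\mu_{xy}>0$ iff $x\sim y$ (neighbors), $\mu_{\min}:=\inf_{(x,y)\in E}\mu_{xy}>0$, $\deg(x):=\sum_{y}\mu_{xy}<\infty$. $m:V\to(0,\infty)$ is a measure on vertices, $m(B)=\sum_{x\in B}m(x)$, $m_{\max}:=\sup_x m(x)$, $D_m:=\max_{x\in V}\deg(x)/m(x)$; $m_{\max}$ and $D_m$ are finite. $d(x,y)$ is the combinatorial graph distance and $B_x(r)=\{y\in V:d(x,y)\le r\}$. Laplacian: $\Delta f(x)=\frac1{m(x)}\sum_{y}\mu_{xy}(f(y)-f(x))$. The eigenvalues $\lambda_i$ are those of $-\Delta$. $\mu$ (without indices) is the infimum of the spectrum of $-\Delta$ on $\ell^2(V,m)$ (so $\mu=0$ for finite $G$). Heat kernel: for finite $G$, $p_t(x,y)=\sum_{i=1}^Ne^{-\lambda_it}\phi_i(x)\phi_i(y)$ where $\{\phi_i\}$ is an orthonormal basis of $\ell^2(V,m)$ with $-\Delta\phi_i=\lambda_i\phi_i$. (In general $p_t$ is the minimal heat kernel, the limit of Dirichlet heat kernels along an exhaustion by finite subsets.) Curvature: $\Gamma(f,g)=\frac12(\Delta(fg)-f\Delta g-g\Delta f)$, $\Gamma_2(f,g)=\frac12(\Delta\Gamma(f,g)-\Gamma(f,\Delta g)-\Gamma(\Delta f,g))$, $\Gamma(f)=\Gamma(f,f)$,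 $\Gamma_2(f)=\Gamma_2(f,f)$. For $n>0$ and $\kappa\in\mathbb R$, $G$ satisfies $CDE(n,\kappa)$ if for every vertex $x$ and every positive $f:V\to\mathbb R$ with $\Delta f(x)<0$ one has, at $x$, $\Gamma_2(f)-\Gamma\bigl(f,\frac{\Gamma(f)}{f}\bigr)\ge\frac1n(\Delta f)^2+\kappa\,\Gamma(f)$. *)

theory Defs
  imports "HOL-Analysis.Analysis"
begin

record 'a wgraph =
  verts :: "'a set"
  wt :: "'a \<Rightarrow> 'a \<Rightarrow> real"
  meas :: "'a \<Rightarrow> real"

text \<open>Only the values of \<open>wt\<close> and \<open>meas\<close> on the vertex set matter.\<close>

definition edges :: "'a wgraph \<Rightarrow> ('a \<times> 'a) set" where
  "edges G = {(x, y). x \<in> verts G \<and> y \<in> verts G \<and> wt G x y > 0}"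

definition nbrs :: "'a wgraph \<Rightarrow> 'a \<Rightarrow> 'a set" where
  "nbrs G x = {y. (x, y) \<in> edges G}"

definition wdeg :: "'a wgraph \<Rightarrow> 'a \<Rightarrow> real" where
  "wdeg G x = (\<Sum>y\<in>nbrs G x. wt G x y)"

definition mu_min :: "'a wgraph \<Rightarrow> real" where
  "mu_min G = (INF (x, y)\<in>edges G. wt G x y)"

definition m_max :: "'a wgraph \<Rightarrow> real" where
  "m_max G = (SUP x\<in>verts G. meas G x)"

definition D_m :: "'a wgraph \<Rightarrow> real" where
  "D_m G = (SUP x\<in>verts G. wdeg G x / meas G x)"

text \<open>
  The standing assumptions on graphs. Loops are not excluded. The edge set is required to be
  nonempty, so that \<open>mu_min\<close> is the infimum of a nonempty set of reals.
\<close>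

locale weighted_graph =
  fixes G :: "'a wgraph"
  assumes edges_nonempty: "edges G \<noteq> {}"
    and wt_nonneg: "\<And>x y. x \<in> verts G \<Longrightarrow> y \<in> verts G \<Longrightarrow> wt G x y \<ge> 0"
    and wt_sym: "\<And>x y. x \<in> verts G \<Longrightarrow> y \<in> verts G \<Longrightarrow> wt G x y = wt G y x"
    and locally_finite: "\<And>x. x \<in> verts G \<Longrightarrow> finite (nbrs G x)"
    and connected: "\<And>x y. x \<in> verts G \<Longrightarrow> y \<in> verts G \<Longrightarrow> (x, y) \<in> (edges G)\<^sup>*"
    and meas_pos: "\<And>x. x \<in> verts G \<Longrightarrow> meas G x > 0"
    and mu_min_pos: "mu_min G > 0"
    and m_max_finite: "bdd_above (meas G ` verts G)"
    and D_m_finite: "bdd_above ((\<lambda>x. wdeg G x / meas G x) ` verts G)"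

definition gdist :: "'a wgraph \<Rightarrow> 'a \<Rightarrow> 'a \<Rightarrow> nat" where
  "gdist G x y = (LEAST k. (x, y) \<in> edges G ^^ k)"

definition gball :: "'a wgraph \<Rightarrow> 'a \<Rightarrow> real \<Rightarrow> 'a set" where
  "gball G x r = {y \<in> verts G. real (gdist G x y) \<le> r}"

definition vol :: "'a wgraph \<Rightarrow> 'a set \<Rightarrow> real" where
  "vol G B = (\<Sum>x\<in>B. meas G x)"

definition diam :: "'a wgraph \<Rightarrow> nat" where
  "diam G = Max {gdist G x y | x y. x \<in> verts G \<and> y \<in> verts G}"

definition lap :: "'a wgraph \<Rightarrow> ('a \<Rightarrow> real) \<Rightarrow> 'a \<Rightarrow> real" where
  "lap G f x = (1 / meas G x) * (\<Sum>y\<in>nbrs G x. wt G x y * (f y - f x))"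

definition Gam :: "'a wgraph \<Rightarrow> ('a \<Rightarrow> real) \<Rightarrow> ('a \<Rightarrow> real) \<Rightarrow> 'a \<Rightarrow> real" where
  "Gam G f g x = (1 / 2) * (lap G (\<lambda>y. f y * g y) x - f x * lap G g x - g x * lap G f x)"

definition Gam2 :: "'a wgraph \<Rightarrow> ('a \<Rightarrow> real) \<Rightarrow> ('a \<Rightarrow> real) \<Rightarrow> 'a \<Rightarrow> real" where
  "Gam2 G f g x = (1 / 2) * (lap G (Gam G f g) x - Gam G f (lap G g) x - Gam G (lap G f) g x)"

definition CDE :: "'a wgraph \<Rightarrow> real \<Rightarrow> real \<Rightarrow> bool" where
  "CDE G n \<kappa> \<longleftrightarrow>
     (\<forall>x\<in>verts G. \<forall>f. (\<forall>y\<in>verts G. f y > 0) \<longrightarrow> lap G f x < 0 \<longrightarrow>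
        Gam2 G f f x - Gam G f (\<lambda>y. Gam G f f y / f y) x
          \<ge> (1 / n) * (lap G f x)\<^sup>2 + \<kappa> * Gam G f f x)"

text \<open>
  Functions on a set \<open>U\<close> of vertices are represented by functions on the whole type vanishing
  off \<open>U\<close>. Since \<open>-\<Delta>\<close> is self-adjoint, its spectrum is real and can be computed in the
  real space \<open>\<ell>\<^sup>2(V, m)\<close>.
\<close>

definition ell2 :: "'a wgraph \<Rightarrow> ('a \<Rightarrow> real) set" where
  "ell2 G = {f. (\<forall>x. x \<notin> verts G \<longrightarrow> f x = 0) \<and>
                (\<lambda>x. meas G x * (f x)\<^sup>2) summable_on verts G}"

definition ell2_norm :: "'a wgraph \<Rightarrow> ('a \<Rightarrow> real) \<Rightarrow> real" where
  "ell2_norm G f = sqrt (\<Sum>\<^sub>\<infinity>x\<in>verts G. meas G x * (f x)\<^sup>2)"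

definition lap_resolvent_set :: "'a wgraph \<Rightarrow> real set" where
  "lap_resolvent_set G =
     {z. bij_betw (\<lambda>f x. - lap G f x - z * f x) (ell2 G) (ell2 G) \<and>
         (\<exists>c. \<forall>f\<in>ell2 G. ell2_norm G f \<le> c * ell2_norm G (\<lambda>x. - lap G f x - z * f x))}"

definition lap_spectrum :: "'a wgraph \<Rightarrow> real set" where
  "lap_spectrum G = - lap_resolvent_set G"

definition spec_bottom :: "'a wgraph \<Rightarrow> real" where
  "spec_bottom G = Inf (lap_spectrum G)"

text \<open>
  Orthonormal eigenbases, indexed by \<open>{1..card U}\<close>, of \<open>-\<Delta>\<close> on the finite set \<open>U\<close> with
  Dirichlet condition off \<open>U\<close>. For \<open>U = verts G\<close> there is no boundary condition and these
  are the orthonormal eigenbases of \<open>-\<Delta>\<close> on \<open>\<ell>\<^sup>2(V, m)\<close>.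
\<close>

definition eigenbasis ::
  "'a wgraph \<Rightarrow> 'a set \<Rightarrow> (nat \<Rightarrow> real) \<Rightarrow> (nat \<Rightarrow> 'a \<Rightarrow> real) \<Rightarrow> bool" where
  "eigenbasis G U lam phi \<longleftrightarrow>
     (\<forall>i\<in>{1..card U}. \<forall>x. x \<notin> U \<longrightarrow> phi i x = 0) \<and>
     (\<forall>i\<in>{1..card U}. \<forall>j\<in>{1..card U}.
        (\<Sum>x\<in>U. meas G x * phi i x * phi j x) = (if i = j then 1 else 0)) \<and>
     (\<forall>f. (\<forall>x. x \<notin> U \<longrightarrow> f x = 0) \<longrightarrow>
        (\<exists>c. f = (\<lambda>x. \<Sum>i=1..card U. c i * phi i x))) \<and>
     (\<forall>i\<in>{1..card U}. \<forall>x\<in>U. - lap G (phi i) x = lam i * phi i x)"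

text \<open>The value below does not depend on the eigenbasis chosen.\<close>

definition dirichlet_heat_kernel ::
  "'a wgraph \<Rightarrow> 'a set \<Rightarrow> real \<Rightarrow> 'a \<Rightarrow> 'a \<Rightarrow> real" where
  "dirichlet_heat_kernel G U t x y =
     (let (lam, phi) = (SOME (lam, phi). eigenbasis G U lam phi)
      in \<Sum>i=1..card U. exp (- lam i * t) * phi i x * phi i y)"

text \<open>
  The minimal heat kernel. Dirichlet heat kernels increase with \<open>U\<close>, so the limit over the
  directed set of finite \<open>U\<close> is the limit along any exhaustion. If \<open>verts G\<close> is finite, the
  filter is principal at \<open>verts G\<close> and the limit is the eigenfunction expansion on \<open>G\<close>.
\<close>

definition heat_kernel :: "'a wgraph \<Rightarrow> real \<Rightarrow> 'a \<Rightarrow> 'a \<Rightarrow> real" where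
  "heat_kernel G t x y =
     Lim (finite_subsets_at_top (verts G)) (\<lambda>U. dirichlet_heat_kernel G U t x y)"

definition heat_kernel_estimate ::
  "'a wgraph \<Rightarrow> real \<Rightarrow> real \<Rightarrow> real \<Rightarrow> real \<Rightarrow> real \<Rightarrow> real \<Rightarrow> real \<Rightarrow> real \<Rightarrow> bool" where
  "heat_kernel_estimate G n K \<epsilon> \<beta> \<gamma> c1 c2 c3 \<longleftrightarrow>
     (\<forall>x\<in>verts G. \<forall>y\<in>verts G. \<forall>t::real. t \<ge> max (\<beta> * real (gdist G x y)) 1 \<longrightarrow>
        heat_kernel G t x y
          \<le> c1 * (exp (- (1 - \<gamma>) * spec_bottom G * t)
                  / sqrt (vol G (gball G x (sqrt t)) * vol G (gball G y (sqrt t))))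
             * exp (- (c3 * (real (gdist G x y))\<^sup>2 / (4 * (1 + 2 * \<epsilon>) * t))
                    + c2 * sqrt (K * n * t)))"

end

theory Submission imports Defs begin

text \<open>
  In the eigenfunction expansion the ground state contributes exactly \<open>1 / m(V)\<close>. For
  \<open>t \<ge> D\<^sup>2\<close> every other term decays at rate at least \<open>\<lambda>\<^sub>2\<close> after time \<open>D\<^sup>2\<close>, and
  \<open>\<bar>\<phi>\<^sub>i(x) \<phi>\<^sub>i(y)\<bar> \<le> (\<phi>\<^sub>i(x)\<^sup>2 + \<phi>\<^sub>i(y)\<^sup>2) / 2\<close> reduces the remainder to the mean of
  \<open>p\<^sub>t(x, x) - 1 / m(V)\<close> and \<open>p\<^sub>t(y, y) - 1 / m(V)\<close> at \<open>t = D\<^sup>2\<close>. There the heat kernel estimate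
  applies on the diagonal, where balls of radius \<open>D\<close> are all of \<open>V\<close>.
\<close>

section \<open>The weighted inner product and expansions in an eigenbasis\<close>

definition ip :: "'a wgraph \<Rightarrow> ('a \<Rightarrow> real) \<Rightarrow> ('a \<Rightarrow> real) \<Rightarrow> real" where
  "ip G f g = (\<Sum>x\<in>verts G. meas G x * f x * g x)"

lemma ip_commute: "ip G f g = ip G g f"
  unfolding ip_def by (simp add: mult_ac)

lemma ip_cong:
  assumes "\<And>x. x \<in> verts G \<Longrightarrow> f x = f' x" "\<And>x. x \<in> verts G \<Longrightarrow> g x = g' x"
  shows "ip G f g = ip G f' g'"
  unfolding ip_def using assms by (intro sum.cong) auto

lemma ip_sum_left: "ip G (\<lambda>x. \<Sum>i\<in>A. c i * f i x) g = (\<Sum>i\<in>A. c i * ip G (f i) g)"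
proof -
  have "ip G (\<lambda>x. \<Sum>i\<in>A. c i * f i x) g
      = (\<Sum>x\<in>verts G. \<Sum>i\<in>A. c i * (meas G x * f i x * g x))"
    unfolding ip_def by (simp add: sum_distrib_left sum_distrib_right mult_ac)
  also have "\<dots> = (\<Sum>i\<in>A. \<Sum>x\<in>verts G. c i * (meas G x * f i x * g x))"
    by (rule sum.swap)
  finally show ?thesis
    unfolding ip_def by (simp add: sum_distrib_left)
qed

lemma ip_scale_left: "ip G (\<lambda>x. c * f x) g = c * ip G f g"
  unfolding ip_def by (simp add: sum_distrib_left mult_ac)

lemma ip_diff_left: "ip G (\<lambda>x. f x - g x) h = ip G f h - ip G g h"
  unfolding ip_def by (simp add: algebra_simps sum_subtractf)

lemma ip_uminus_left: "ip G (\<lambda>x. - f x) g = - ip G f g"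
  unfolding ip_def by (simp add: sum_negf)

text \<open>A point off the vertex set has no neighbours, so the sum is empty. This keeps the
  Laplacian inside the space of functions supported on the vertices.\<close>

lemma lap_off_verts: "x \<notin> verts G \<Longrightarrow> lap G f x = 0"
  by (simp add: lap_def nbrs_def edges_def)

lemma eigenbasis_off:
  assumes "eigenbasis G U lam phi" "i \<in> {1..card U}" "x \<notin> U"
  shows "phi i x = 0"
  using assms unfolding eigenbasis_def by blast

lemma eigenbasis_orthonormal:
  assumes "eigenbasis G (verts G) lam phi"
    and "i \<in> {1..card (verts G)}" "j \<in> {1..card (verts G)}"
  shows "ip G (phi i) (phi j) = (if i = j then 1 else 0)"
  using assms unfolding eigenbasis_def ip_def by blast

lemma eigenbasis_eigen:
  assumes "eigenbasis G U lam phi" "i \<in> {1..card U}" "x \<in> U"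
  shows "lap G (phi i) x = - lam i * phi i x"
proof -
  have "- lap G (phi i) x = lam i * phi i x"
    using assms unfolding eigenbasis_def by blast
  then show ?thesis by simp
qed

lemma ip_eigenbasis_sum:
  assumes "eigenbasis G (verts G) lam phi" "j \<in> {1..card (verts G)}"
  shows "ip G (\<lambda>x. \<Sum>i=1..card (verts G). c i * phi i x) (phi j) = c j"
proof -
  have "ip G (\<lambda>x. \<Sum>i=1..card (verts G). c i * phi i x) (phi j)
      = (\<Sum>i=1..card (verts G). if i = j then c i else 0)"
    unfolding ip_sum_left
    by (rule sum.cong) (auto simp: eigenbasis_orthonormal[OF assms(1) _ assms(2)])
  then show ?thesis using assms(2) by simp
qed

text \<open>Spanning supplies some coefficients, and pairing with \<open>phi j\<close> identifies
  them by orthonormality.\<close>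

lemma eigenbasis_expansion:
  assumes "eigenbasis G (verts G) lam phi" "\<And>x. x \<notin> verts G \<Longrightarrow> f x = 0"
  shows "f x = (\<Sum>i=1..card (verts G). ip G f (phi i) * phi i x)"
proof -
  obtain c where c: "f = (\<lambda>x. \<Sum>i=1..card (verts G). c i * phi i x)"
    using assms unfolding eigenbasis_def by blast
  have "ip G f (phi j) = c j" if "j \<in> {1..card (verts G)}" for j
    using ip_eigenbasis_sum[OF assms(1) that, of c] c by simp
  then have "(\<Sum>i=1..card (verts G). ip G f (phi i) * phi i x)
      = (\<Sum>i=1..card (verts G). c i * phi i x)"
    by (intro sum.cong) auto
  then show ?thesis using c by simp
qed

text \<open>Reduces identities between functions to identities between coefficients, where the
  operators studied below act diagonally.\<close>

lemma eigenbasis_ext: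
  assumes "eigenbasis G (verts G) lam phi"
    and "\<And>x. x \<notin> verts G \<Longrightarrow> f x = 0" "\<And>x. x \<notin> verts G \<Longrightarrow> g x = 0"
    and "\<And>i. i \<in> {1..card (verts G)} \<Longrightarrow> ip G f (phi i) = ip G g (phi i)"
  shows "f = g"
proof
  fix x
  show "f x = g x"
    using eigenbasis_expansion[of G lam phi f x] eigenbasis_expansion[of G lam phi g x] assms
    by simp
qed

lemma eigenbasis_parseval:
  assumes "eigenbasis G (verts G) lam phi" "\<And>x. x \<notin> verts G \<Longrightarrow> f x = 0"
  shows "ip G f f = (\<Sum>i=1..card (verts G). (ip G f (phi i))\<^sup>2)"
proof -
  have "ip G f f = ip G (\<lambda>x. \<Sum>i=1..card (verts G). ip G f (phi i) * phi i x) f"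
    by (intro ip_cong refl eigenbasis_expansion[OF assms])
  also have "\<dots> = (\<Sum>i=1..card (verts G). ip G f (phi i) * ip G (phi i) f)"
    by (rule ip_sum_left)
  finally show ?thesis
    by (simp only: power2_eq_square ip_commute[of G "phi _" f])
qed

section \<open>The Laplacian of a finite graph as a symmetric form\<close>

locale finite_weighted_graph = weighted_graph +
  assumes finite_verts: "finite (verts G)"
begin

text \<open>Non-neighbours carry weight zero. Summing over a range independent of \<open>x\<close>
  allows double sums to be swapped.\<close>

lemma lap_eq_sum_verts:
  assumes "x \<in> verts G"
  shows "lap G f x = (1 / meas G x) * (\<Sum>y\<in>verts G. wt G x y * (f y - f x))"
proof -
  have "(\<Sum>y\<in>nbrs G x. wt G x y * (f y - f x)) = (\<Sum>y\<in>verts G. wt G x y * (f y - f x))"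
  proof (rule sum.mono_neutral_left[OF finite_verts])
    show "nbrs G x \<subseteq> verts G" by (auto simp: nbrs_def edges_def)
    show "\<forall>y\<in>verts G - nbrs G x. wt G x y * (f y - f x) = 0"
      using wt_nonneg assms by (fastforce simp: nbrs_def edges_def)
  qed
  then show ?thesis by (simp add: lap_def)
qed

text \<open>Green's formula. Exchanging the roles of \<open>x\<close> and \<open>y\<close> in the
  double sum flips the sign of \<open>f y - f x\<close>, while the weight is symmetric; averaging
  the two forms produces \<open>g y - g x\<close>. Self-adjointness and the sign of the form can be
  read off.\<close>

lemma ip_lap_left:
  "ip G (lap G f) g
    = - (1/2) * (\<Sum>x\<in>verts G. \<Sum>y\<in>verts G. wt G x y * (f y - f x) * (g y - g x))"
proof -
  let ?S = "\<Sum>x\<in>verts G. \<Sum>y\<in>verts G. wt G x y * (f y - f x) * g x"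
  have 1: "ip G (lap G f) g = ?S"
    unfolding ip_def
  proof (rule sum.cong[OF refl])
    fix x assume x: "x \<in> verts G"
    show "meas G x * lap G f x * g x = (\<Sum>y\<in>verts G. wt G x y * (f y - f x) * g x)"
      using meas_pos[OF x] by (simp add: lap_eq_sum_verts[OF x] sum_distrib_right)
  qed
  have "?S = (\<Sum>y\<in>verts G. \<Sum>x\<in>verts G. wt G x y * (f y - f x) * g x)"
    by (rule sum.swap)
  also have "\<dots> = (\<Sum>x\<in>verts G. \<Sum>y\<in>verts G. - (wt G x y * (f y - f x) * g y))"
    by (intro sum.cong refl) (simp add: wt_sym algebra_simps)
  finally have 2: "?S = \<dots>" .
  have "2 * ?S = ?S + (\<Sum>x\<in>verts G. \<Sum>y\<in>verts G. - (wt G x y * (f y - f x) * g y))"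
    using 2 by simp
  also have "\<dots> = - (\<Sum>x\<in>verts G. \<Sum>y\<in>verts G. wt G x y * (f y - f x) * (g y - g x))"
    by (simp add: sum.distrib[symmetric] sum_negf[symmetric] algebra_simps)
  finally show ?thesis using 1 by simp
qed

lemma lap_self_adjoint: "ip G (lap G f) g = ip G f (lap G g)"
  by (simp add: ip_lap_left ip_commute[of G f] mult_ac)

lemma ip_lap_nonpos: "ip G (lap G f) f \<le> 0"
proof -
  have "0 \<le> (\<Sum>x\<in>verts G. \<Sum>y\<in>verts G. wt G x y * (f y - f x) * (f y - f x))"
    by (intro sum_nonneg) (simp add: wt_nonneg mult.assoc)
  then show ?thesis by (simp add: ip_lap_left)
qed

text \<open>The Dirichlet energy is a sum of nonnegative terms, so its vanishing kills each of them.
  Edge weights are positive, so \<open>f\<close> agrees across every edge, and connectedness spreads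
  this to all vertices.\<close>

lemma harmonic_constant:
  assumes "ip G (lap G f) f = 0" "x \<in> verts G" "y \<in> verts G"
  shows "f x = f y"
proof -
  have nn: "0 \<le> wt G x y * (f y - f x) * (f y - f x)" if "x \<in> verts G" "y \<in> verts G" for x y
    using wt_nonneg[OF that] by (simp add: mult.assoc)
  have "(\<Sum>x\<in>verts G. \<Sum>y\<in>verts G. wt G x y * (f y - f x) * (f y - f x)) = 0"
    using assms(1) by (simp add: ip_lap_left)
  then have row: "\<forall>x\<in>verts G. (\<Sum>y\<in>verts G. wt G x y * (f y - f x) * (f y - f x)) = 0"
    by (subst (asm) sum_nonneg_eq_0_iff) (auto intro!: sum_nonneg nn finite_verts)
  then have zero: "wt G x y * (f y - f x) * (f y - f x) = 0"
    if x: "x \<in> verts G" and y: "y \<in> verts G" for x y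
  proof -
    have "(\<Sum>y\<in>verts G. wt G x y * (f y - f x) * (f y - f x)) = 0"
      using row x by blast
    then have "\<forall>y\<in>verts G. wt G x y * (f y - f x) * (f y - f x) = 0"
      using sum_nonneg_eq_0_iff[OF finite_verts, of "\<lambda>y. wt G x y * (f y - f x) * (f y - f x)"]
        nn[OF x] by simp
    then show ?thesis using y by blast
  qed
  have edge: "f x = f y" if "(x, y) \<in> edges G" for x y
    using that zero[of x y] by (auto simp: edges_def)
  have "(x, y) \<in> (edges G)\<^sup>*" using connected assms by blast
  then show ?thesis by induction (auto dest: edge)
qed

section \<open>Eigenvalues, and the heat kernel as an eigenfunction expansion\<close>

lemma ip_lap_eigen:
  assumes "eigenbasis G (verts G) lam phi" "i \<in> {1..card (verts G)}"
  shows "ip G (lap G f) (phi i) = - lam i * ip G f (phi i)"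
proof -
  \<comment> \<open>Self-adjointness moves the Laplacian onto \<open>phi i\<close>, where it acts as
    multiplication by \<open>- lam i\<close>.\<close>
  have "ip G (lap G f) (phi i) = ip G (lap G (phi i)) f"
    by (metis lap_self_adjoint ip_commute)
  also have "\<dots> = ip G (\<lambda>x. - lam i * phi i x) f"
    by (rule ip_cong) (use eigenbasis_eigen[OF assms] in auto)
  also have "\<dots> = - lam i * ip G f (phi i)"
    by (simp only: ip_scale_left ip_commute[of G f])
  finally show ?thesis .
qed

lemma eigenvalue_nonneg:
  assumes "eigenbasis G (verts G) lam phi" "i \<in> {1..card (verts G)}"
  shows "lam i \<ge> 0"
  using ip_lap_nonpos[of "phi i"] ip_lap_eigen[OF assms, of "phi i"]
    eigenbasis_orthonormal[OF assms(1) assms(2) assms(2)] by simp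

text \<open>The kernel is defined through an eigenbasis picked by choice, so it must be shown equal
  to the expansion in the given one. The change-of-basis matrix \<open>a\<close> links only equal
  eigenvalues, hence \<open>h (lam' j)\<close> may be traded for \<open>h (lam i)\<close> wherever
  \<open>a i j\<close> is nonzero.\<close>

lemma eigen_sum_unique:
  assumes B: "eigenbasis G (verts G) lam phi" and B': "eigenbasis G (verts G) lam' phi'"
  shows "(\<Sum>j=1..card (verts G). h (lam' j) * phi' j x * phi' j y)
    = (\<Sum>i=1..card (verts G). (h (lam i) :: real) * phi i x * phi i y)"
proof -
  let ?I = "{1..card (verts G)}"
  define a where "a i j = ip G (phi i) (phi' j)" for i j
  have a: "h (lam' j) * a i j = h (lam i) * a i j" if "i \<in> ?I" "j \<in> ?I" for i j
  proof -
    \<comment> \<open>Both sides are minus the Laplacian form evaluated at \<open>phi i\<close> and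
      \<open>phi' j\<close>.\<close>
    have "lam' j * a i j = lam i * a i j"
      using ip_lap_eigen[OF B' that(2), of "phi i"] ip_lap_eigen[OF B that(1), of "phi' j"]
        lap_self_adjoint[of "phi i" "phi' j"]
      unfolding a_def ip_commute[of G "phi' j" "phi i"] ip_commute[of G "phi i" "lap G (phi' j)"]
      by linarith
    \<comment> \<open>Either \<open>a i j = 0\<close> or the two eigenvalues coincide.\<close>
    then show ?thesis by auto
  qed
  have e': "phi' j x = (\<Sum>i\<in>?I. a i j * phi i x)" if "j \<in> ?I" for j
    using eigenbasis_expansion[OF B, of "phi' j" x] eigenbasis_off[OF B' that]
    by (simp add: a_def ip_commute)
  have e: "phi i y = (\<Sum>j\<in>?I. a i j * phi' j y)" if "i \<in> ?I" for i
    using eigenbasis_expansion[OF B', of "phi i" y] eigenbasis_off[OF B that]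
    by (simp add: a_def)
  \<comment> \<open>Expand \<open>phi' j x\<close> in the unprimed basis, replace the eigenvalue,
    swap the sums, and collect the primed functions at \<open>y\<close> back into
    \<open>phi i y\<close>.\<close>
  have "(\<Sum>j\<in>?I. h (lam' j) * phi' j x * phi' j y)
      = (\<Sum>j\<in>?I. \<Sum>i\<in>?I. (h (lam' j) * a i j) * phi i x * phi' j y)"
    by (intro sum.cong refl) (simp add: e' sum_distrib_left sum_distrib_right mult_ac)
  also have "\<dots> = (\<Sum>j\<in>?I. \<Sum>i\<in>?I. (h (lam i) * a i j) * phi i x * phi' j y)"
    by (intro sum.cong refl) (simp add: a)
  also have "\<dots> = (\<Sum>i\<in>?I. \<Sum>j\<in>?I. (h (lam i) * a i j) * phi i x * phi' j y)"
    by (rule sum.swap)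
  also have "\<dots> = (\<Sum>i\<in>?I. h (lam i) * phi i x * (\<Sum>j\<in>?I. a i j * phi' j y))"
    by (intro sum.cong refl) (simp add: sum_distrib_left mult_ac)
  also have "\<dots> = (\<Sum>i\<in>?I. h (lam i) * phi i x * phi i y)"
    by (intro sum.cong refl) (simp add: e)
  finally show ?thesis .
qed

lemma heat_kernel_eigen_sum:
  assumes B: "eigenbasis G (verts G) lam phi"
  shows "heat_kernel G t x y = (\<Sum>i=1..card (verts G). exp (- lam i * t) * phi i x * phi i y)"
proof -
  obtain lam' phi' where some: "(SOME (lam, phi). eigenbasis G (verts G) lam phi) = (lam', phi')"
    by fastforce
  have "case (SOME (lam, phi). eigenbasis G (verts G) lam phi) of
      (lam, phi) \<Rightarrow> eigenbasis G (verts G) lam phi"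
    by (rule someI[of _ "(lam, phi)"]) (use B in simp)
  then have B': "eigenbasis G (verts G) lam' phi'" using some by simp
  have "((\<lambda>U. dirichlet_heat_kernel G U t x y) \<longlongrightarrow> dirichlet_heat_kernel G (verts G) t x y)
      (finite_subsets_at_top (verts G))"
    unfolding finite_subsets_at_top_finite[OF finite_verts]
    by (rule tendsto_principal_singleton)
  then have "heat_kernel G t x y = dirichlet_heat_kernel G (verts G) t x y"
    unfolding heat_kernel_def by (intro tendsto_Lim) auto
  also have "\<dots> = (\<Sum>j=1..card (verts G). exp (- lam' j * t) * phi' j x * phi' j y)"
    by (simp add: dirichlet_heat_kernel_def some)
  also have "\<dots> = (\<Sum>i=1..card (verts G). exp (- lam i * t) * phi i x * phi i y)"
    by (rule eigen_sum_unique[OF B B', where h = "\<lambda>l. exp (- l * t)"])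
  finally show ?thesis .
qed

section \<open>The ground state\<close>

lemma verts_nonempty: "verts G \<noteq> {}"
  using edges_nonempty by (auto simp: edges_def)

lemma vol_verts_pos: "vol G (verts G) > 0"
  unfolding vol_def using finite_verts verts_nonempty meas_pos by (intro sum_pos) auto

text \<open>If the smallest eigenvalue were positive, all would be. The indicator of the vertex set
  is harmonic, so all its coefficients would vanish, making it zero.\<close>

lemma ground_eigenvalue:
  assumes B: "eigenbasis G (verts G) lam phi" and mono: "mono_on {1..card (verts G)} lam"
  shows "lam 1 = 0"
proof (rule ccontr)
  assume "lam 1 \<noteq> 0"
  let ?I = "{1..card (verts G)}"
  let ?u = "\<lambda>x. if x \<in> verts G then 1 else 0 :: real"
  have one: "1 \<in> ?I" using verts_nonempty finite_verts by (simp add: Suc_le_eq card_gt_0_iff)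
  then have "lam 1 > 0" using eigenvalue_nonneg[OF B one] \<open>lam 1 \<noteq> 0\<close> by simp
  then have pos: "lam i > 0" if "i \<in> ?I" for i
    using mono_onD[OF mono one that] that by simp
  have "lap G ?u x = 0" if "x \<in> verts G" for x
    by (simp add: lap_eq_sum_verts[OF that] that)
  then have "ip G (lap G ?u) (phi i) = 0" for i
    unfolding ip_def by simp
  then have "ip G ?u (phi i) = 0" if "i \<in> ?I" for i
    using ip_lap_eigen[OF B that, of ?u] pos[OF that] by simp
  then have "?u x = 0" for x
    using eigenbasis_expansion[OF B, of ?u x] by simp
  moreover obtain x where "x \<in> verts G" using verts_nonempty by blast
  then have "?u x = 1" by simp
  ultimately show False by fastforce
qed

text \<open>Eigenvalue 0 means zero energy, so \<open>phi 1\<close> is constant on the vertices, and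
  normalisation makes the square of the constant the reciprocal of the volume.\<close>

lemma ground_state:
  assumes B: "eigenbasis G (verts G) lam phi" and mono: "mono_on {1..card (verts G)} lam"
    and x: "x \<in> verts G" and y: "y \<in> verts G"
  shows "phi 1 x * phi 1 y = 1 / vol G (verts G)"
proof -
  have one: "1 \<in> {1..card (verts G)}"
    using verts_nonempty finite_verts by (simp add: Suc_le_eq card_gt_0_iff)
  have "ip G (lap G (phi 1)) (phi 1) = 0"
    using ip_lap_eigen[OF B one] ground_eigenvalue[OF B mono] by simp
  then have const: "phi 1 z = phi 1 x" if "z \<in> verts G" for z
    using harmonic_constant that x by blast
  have "1 = ip G (phi 1) (phi 1)"
    using eigenbasis_orthonormal[OF B one one] by simp
  also have "\<dots> = ip G (\<lambda>_. phi 1 x) (\<lambda>_. phi 1 x)"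
    by (rule ip_cong) (use const in auto)
  also have "\<dots> = vol G (verts G) * (phi 1 x * phi 1 x)"
    unfolding ip_def vol_def by (simp only: sum_distrib_right mult.assoc)
  finally show ?thesis
    using const[OF y] vol_verts_pos by (simp add: field_simps)
qed

section \<open>The bottom of the spectrum\<close>

lemma ell2_eq: "ell2 G = {f. \<forall>x. x \<notin> verts G \<longrightarrow> f x = 0}"
  unfolding ell2_def using finite_verts by auto

lemma ell2_norm_eq: "ell2_norm G f = sqrt (ip G f f)"
  unfolding ell2_norm_def ip_def using finite_verts
  by (simp add: power2_eq_square mult.assoc)

text \<open>In the eigenbasis the operator \<open>T\<close> multiplies coefficients by
  \<open>lam i - z\<close>, which is at least \<open>- z > 0\<close>. Hence it is invertible, with
  inverse of norm at most \<open>1 / - z\<close>.\<close>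

lemma neg_in_resolvent_set:
  assumes B: "eigenbasis G (verts G) lam phi" and z: "z < 0"
  shows "z \<in> lap_resolvent_set G"
proof -
  let ?I = "{1..card (verts G)}"
  define T where "T = (\<lambda>f x. - lap G f x - z * f x)"
  have coeff: "ip G (T f) (phi i) = (lam i - z) * ip G f (phi i)" if "i \<in> ?I" for f i
    unfolding T_def
    by (simp add: ip_diff_left ip_uminus_left ip_scale_left ip_lap_eigen[OF B that]
        algebra_simps)
  have pos: "lam i - z \<ge> - z" if "i \<in> ?I" for i
    using eigenvalue_nonneg[OF B that] by simp
  have T_ell2: "T f \<in> ell2 G" if "f \<in> ell2 G" for f
    using that by (simp add: ell2_eq T_def lap_off_verts)
  have inj: "inj_on T (ell2 G)"
  proof (rule inj_onI)
    fix f g assume fg: "f \<in> ell2 G" "g \<in> ell2 G" "T f = T g"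
    show "f = g"
    proof (rule eigenbasis_ext[OF B])
      fix i assume i: "i \<in> ?I"
      show "ip G f (phi i) = ip G g (phi i)"
        using coeff[OF i, of f] coeff[OF i, of g] fg(3) pos[OF i] z by simp
    qed (use fg in \<open>auto simp: ell2_eq\<close>)
  qed
  have surj: "T ` ell2 G = ell2 G"
  proof (intro equalityI subsetI)
    fix h assume h: "h \<in> ell2 G"
    \<comment> \<open>The preimage of \<open>h\<close> is obtained by dividing each coefficient by
      its factor.\<close>
    define f where "f = (\<lambda>x. \<Sum>i=1..card (verts G). (ip G h (phi i) / (lam i - z)) * phi i x)"
    have f: "f \<in> ell2 G"
      by (auto simp: ell2_eq f_def eigenbasis_off[OF B] intro!: sum.neutral)
    have "T f = h"
    proof (rule eigenbasis_ext[OF B])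
      fix i assume i: "i \<in> ?I"
      have "ip G f (phi i) = ip G h (phi i) / (lam i - z)"
        unfolding f_def by (rule ip_eigenbasis_sum[OF B i])
      then show "ip G (T f) (phi i) = ip G h (phi i)"
        using coeff[OF i, of f] pos[OF i] z by simp
    qed (use h T_ell2[OF f] in \<open>auto simp: ell2_eq\<close>)
    then show "h \<in> T ` ell2 G" using f by blast
  qed (use T_ell2 in auto)
  have bounded: "ell2_norm G f \<le> (1 / - z) * ell2_norm G (T f)" if f: "f \<in> ell2 G" for f
  proof -
    \<comment> \<open>Parseval turns the norm bound into a comparison of squared
      coefficients.\<close>
    have "z\<^sup>2 * ip G f f = (\<Sum>i\<in>?I. (- z * ip G f (phi i))\<^sup>2)"
      using f by (simp add: eigenbasis_parseval[OF B] ell2_eq sum_distrib_left power_mult_distrib)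
    also have "\<dots> \<le> (\<Sum>i\<in>?I. ((lam i - z) * ip G f (phi i))\<^sup>2)"
    proof (rule sum_mono)
      fix i assume i: "i \<in> ?I"
      have "(- z)\<^sup>2 \<le> (lam i - z)\<^sup>2" using pos[OF i] z by (intro power_mono) auto
      then show "(- z * ip G f (phi i))\<^sup>2 \<le> ((lam i - z) * ip G f (phi i))\<^sup>2"
        unfolding power_mult_distrib by (intro mult_right_mono) auto
    qed
    also have "\<dots> = (\<Sum>i\<in>?I. (ip G (T f) (phi i))\<^sup>2)"
      by (intro sum.cong refl) (simp add: coeff)
    also have "\<dots> = ip G (T f) (T f)"
      using T_ell2[OF f] by (simp add: eigenbasis_parseval[OF B] ell2_eq)
    finally have "sqrt (z\<^sup>2 * ip G f f) \<le> sqrt (ip G (T f) (T f))" by simp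
    then have "- z * ell2_norm G f \<le> ell2_norm G (T f)"
      using z by (simp add: ell2_norm_eq real_sqrt_mult)
    then show ?thesis using z by (simp add: field_simps)
  qed
  have "bij_betw T (ell2 G) (ell2 G) \<and>
      (\<exists>c. \<forall>f\<in>ell2 G. ell2_norm G f \<le> c * ell2_norm G (T f))"
    using inj surj bounded by (intro conjI exI[of _ "1 / - z"] ballI) (auto simp: bij_betw_def)
  then show ?thesis
    unfolding lap_resolvent_set_def T_def mem_Collect_eq .
qed

text \<open>The indicator \<open>u\<close> of the vertex set is a nonzero element of the kernel, so
  injectivity fails at 0.\<close>

lemma zero_in_spectrum: "0 \<in> lap_spectrum G"
  unfolding lap_spectrum_def
proof (rule ComplI)
  let ?T = "\<lambda>f x. - lap G f x - 0 * f x"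
  define u :: "'a \<Rightarrow> real" where "u x = (if x \<in> verts G then 1 else 0)" for x
  assume "0 \<in> lap_resolvent_set G"
  then have inj: "inj_on ?T (ell2 G)"
    by (simp add: lap_resolvent_set_def bij_betw_def)
  have "lap G u x = 0" for x
  proof (cases "x \<in> verts G")
    case True
    then show ?thesis by (simp add: lap_eq_sum_verts[OF True] u_def)
  qed (rule lap_off_verts)
  moreover have "lap G (\<lambda>_. 0) x = 0" for x
    by (simp add: lap_def)
  ultimately have "?T u = ?T (\<lambda>_. 0)" by simp
  moreover have "u \<in> ell2 G" "(\<lambda>_. 0) \<in> ell2 G"
    by (simp_all add: ell2_eq u_def)
  ultimately have "u = (\<lambda>_. 0)"
    by (rule inj_onD[OF inj])
  then have "u x = 0" for x by simp
  moreover obtain x where "x \<in> verts G" using verts_nonempty by blast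
  then have "u x = 1" by (simp add: u_def)
  ultimately show False by simp
qed

text \<open>The spectrum contains 0 and nothing negative. The factor
  \<open>exp (- (1 - \<gamma>) * spec_bottom G * t)\<close> in the estimate therefore equals
  1.\<close>

lemma spec_bottom_eq_0:
  assumes "eigenbasis G (verts G) lam phi"
  shows "spec_bottom G = 0"
  unfolding spec_bottom_def
proof (rule cInf_eq_minimum[OF zero_in_spectrum])
  fix z assume "z \<in> lap_spectrum G"
  then have "z \<notin> lap_resolvent_set G" by (simp add: lap_spectrum_def)
  then show "0 \<le> z" using neg_in_resolvent_set[OF assms, of z] by linarith
qed

section \<open>Distances, diameter and balls\<close>

lemma gdist_self: "gdist G x x = 0"
  unfolding gdist_def by (rule Least_eq_0) simp

lemma gdist_relpow:
  assumes "x \<in> verts G" "y \<in> verts G"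
  shows "(x, y) \<in> edges G ^^ gdist G x y"
proof -
  obtain k where "(x, y) \<in> edges G ^^ k"
    using rtrancl_imp_relpow[OF connected[OF assms]] by blast
  then show ?thesis unfolding gdist_def by (rule LeastI)
qed

lemma gdist_le_diam:
  assumes "x \<in> verts G" "y \<in> verts G"
  shows "gdist G x y \<le> diam G"
proof -
  have "{gdist G x y | x y. x \<in> verts G \<and> y \<in> verts G}
      = (\<lambda>(x, y). gdist G x y) ` (verts G \<times> verts G)" by auto
  then have "finite {gdist G x y | x y. x \<in> verts G \<and> y \<in> verts G}"
    using finite_verts by simp
  then show ?thesis unfolding diam_def using assms by (intro Max_ge) auto
qed

text \<open>Distinct vertices have nonzero distance. This makes the squared diameter an admissible
  time, at least 1, for the heat kernel estimate.\<close>

lemma diam_ge_1: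
  assumes "card (verts G) \<ge> 2"
  shows "diam G \<ge> 1"
proof -
  have "\<not> card (verts G) \<le> Suc 0" using assms by simp
  then obtain x y where xy: "x \<in> verts G" "y \<in> verts G" "x \<noteq> y"
    unfolding card_le_Suc0_iff_eq[OF finite_verts] by blast
  have "gdist G x y \<noteq> 0"
  proof
    assume "gdist G x y = 0"
    then show False using gdist_relpow[OF xy(1,2)] xy(3) by simp
  qed
  then show ?thesis using gdist_le_diam[OF xy(1,2)] by simp
qed

lemma gball_diam:
  assumes "x \<in> verts G"
  shows "gball G x (real (diam G)) = verts G"
  using gdist_le_diam[OF assms] by (auto simp: gball_def)

section \<open>Convergence to equilibrium\<close>

lemma heat_kernel_minus_ground_state:
  assumes B: "eigenbasis G (verts G) lam phi" and mono: "mono_on {1..card (verts G)} lam"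
    and x: "x \<in> verts G" and y: "y \<in> verts G"
  shows "heat_kernel G t x y - 1 / vol G (verts G)
    = (\<Sum>i=2..card (verts G). exp (- lam i * t) * phi i x * phi i y)"
proof -
  have "1 \<le> card (verts G)"
    using verts_nonempty finite_verts by (simp add: Suc_le_eq card_gt_0_iff)
  then have "heat_kernel G t x y = exp (- lam 1 * t) * phi 1 x * phi 1 y
      + (\<Sum>i=2..card (verts G). exp (- lam i * t) * phi i x * phi i y)"
    unfolding heat_kernel_eigen_sum[OF B] by (subst sum.atLeast_Suc_atMost) (auto simp: numeral_2_eq_2)
  then show ?thesis
    using ground_state[OF B mono x y] ground_eigenvalue[OF B mono] by simp
qed

lemma heat_kernel_convergence:
  assumes B: "eigenbasis G (verts G) lam phi" and mono: "mono_on {1..card (verts G)} lam"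
    and x: "x \<in> verts G" and y: "y \<in> verts G" and st: "s \<le> t"
  shows "\<bar>heat_kernel G t x y - 1 / vol G (verts G)\<bar>
    \<le> ((heat_kernel G s x x - 1 / vol G (verts G)) + (heat_kernel G s y y - 1 / vol G (verts G))) / 2
      * exp (lam 2 * s - lam 2 * t)"
proof -
  let ?I = "{2..card (verts G)}"
  let ?E = "exp (lam 2 * s - lam 2 * t)"
  have bound: "\<bar>exp (- lam i * t) * phi i x * phi i y\<bar>
      \<le> (exp (- lam i * s) * phi i x * phi i x + exp (- lam i * s) * phi i y * phi i y) / 2 * ?E"
    if i: "i \<in> ?I" for i
  proof -
    \<comment> \<open>The existence of \<open>i\<close> forces at least two vertices, so index 2 is
      in the range of monotonicity; with a single vertex the sum is empty.\<close>
    have "lam 2 \<le> lam i" using mono i by (auto intro: mono_onD)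
    then have "lam 2 * (t - s) \<le> lam i * (t - s)" using st by (intro mult_right_mono) auto
    \<comment> \<open>Decay up to time \<open>s\<close> is kept exactly for each \<open>i\<close>;
      only the decay over \<open>t - s\<close> is weakened to rate \<open>lam 2\<close>.\<close>
    then have "exp (- lam i * t) \<le> exp (- lam i * s) * ?E"
      by (simp add: exp_add[symmetric] algebra_simps)
    moreover have "\<bar>phi i x * phi i y\<bar> \<le> (phi i x * phi i x + phi i y * phi i y) / 2"
      using sum_squares_bound[of "\<bar>phi i x\<bar>" "\<bar>phi i y\<bar>"]
      by (simp add: abs_mult power2_eq_square)
    ultimately have "exp (- lam i * t) * \<bar>phi i x * phi i y\<bar>
        \<le> (exp (- lam i * s) * ?E) * ((phi i x * phi i x + phi i y * phi i y) / 2)"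
      by (intro mult_mono) auto
    then show ?thesis by (simp add: abs_mult algebra_simps add_divide_distrib)
  qed
  have "\<bar>heat_kernel G t x y - 1 / vol G (verts G)\<bar>
      \<le> (\<Sum>i\<in>?I. \<bar>exp (- lam i * t) * phi i x * phi i y\<bar>)"
    unfolding heat_kernel_minus_ground_state[OF B mono x y] by (rule sum_abs)
  also have "\<dots> \<le> (\<Sum>i\<in>?I. (exp (- lam i * s) * phi i x * phi i x
      + exp (- lam i * s) * phi i y * phi i y) / 2 * ?E)"
    by (rule sum_mono) (rule bound)
  also have "\<dots> = ((heat_kernel G s x x - 1 / vol G (verts G))
      + (heat_kernel G s y y - 1 / vol G (verts G))) / 2 * ?E"
    unfolding heat_kernel_minus_ground_state[OF B mono x x] heat_kernel_minus_ground_state[OF B mono y y]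
    by (simp add: sum_distrib_right sum_divide_distrib sum.distrib[symmetric])
  finally show ?thesis .
qed

lemma heat_kernel_diagonal_at_diam:
  assumes B: "eigenbasis G (verts G) lam phi" and card: "card (verts G) \<ge> 2"
    and est: "heat_kernel_estimate G n K \<epsilon> \<beta> \<gamma> c1 c2 c3" and x: "x \<in> verts G"
  shows "heat_kernel G ((real (diam G))\<^sup>2) x x
    \<le> 1 / vol G (verts G) * (c1 * exp (c2 * sqrt (K * n) * real (diam G)))"
proof -
  let ?D = "real (diam G)"
  \<comment> \<open>On the diagonal the distance is 0, so only the lower bound 1 on the time
    remains.\<close>
  have "?D\<^sup>2 \<ge> max (\<beta> * real (gdist G x x)) 1"
    using diam_ge_1[OF card] by (simp add: gdist_self)
  then have "heat_kernel G (?D\<^sup>2) x x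
      \<le> c1 * (exp (- (1 - \<gamma>) * spec_bottom G * ?D\<^sup>2)
            / sqrt (vol G (gball G x (sqrt (?D\<^sup>2))) * vol G (gball G x (sqrt (?D\<^sup>2)))))
        * exp (- (c3 * (real (gdist G x x))\<^sup>2 / (4 * (1 + 2 * \<epsilon>) * ?D\<^sup>2))
            + c2 * sqrt (K * n * ?D\<^sup>2))"
    using est x unfolding heat_kernel_estimate_def by blast
  \<comment> \<open>The spectral factor is 1, the Gaussian term vanishes at distance 0, and both
    balls of radius \<open>?D\<close> are the whole vertex set, so the square root is the total
    volume.\<close>
  also have "\<dots> = 1 / vol G (verts G) * (c1 * exp (c2 * sqrt (K * n) * ?D))"
    using vol_verts_pos
    by (simp add: spec_bottom_eq_0[OF B] gball_diam[OF x] gdist_self real_sqrt_mult mult_ac)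
  finally show ?thesis .
qed

end

theorem corollary4p1:
  fixes G :: "'a wgraph"
    and n K \<epsilon> \<beta> \<gamma> :: real
    and C1 C2 :: "real \<Rightarrow> real \<Rightarrow> real \<Rightarrow> real \<Rightarrow> real \<Rightarrow> real \<Rightarrow> real \<Rightarrow> real"
    and C3 :: "real \<Rightarrow> real \<Rightarrow> real \<Rightarrow> real"
    and lam :: "nat \<Rightarrow> real" and phi :: "nat \<Rightarrow> 'a \<Rightarrow> real"
    and x y :: 'a and t :: real
  assumes graph: "weighted_graph G"
    and finite: "finite (verts G)" "card (verts G) \<ge> 2"
    and eigenvalues: "eigenbasis G (verts G) lam phi" "mono_on {1..card (verts G)} lam"
    and params: "n > 0" "K \<ge> 0" "\<epsilon> > 0" "0 < \<gamma>" "\<gamma> \<le> 1" "\<beta> > 0"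
    and curvature: "CDE G n (- K)"
    and C3_pos: "\<And>H :: 'a wgraph. weighted_graph H \<Longrightarrow> C3 \<gamma> \<beta> (D_m H) > 0"
    and estimate: "\<And>H :: 'a wgraph. weighted_graph H \<Longrightarrow> CDE H n (- K) \<Longrightarrow>
          heat_kernel_estimate H n K \<epsilon> \<beta> \<gamma>
            (C1 n \<epsilon> \<beta> \<gamma> (D_m H) (m_max H) (mu_min H))
            (C2 n \<epsilon> \<beta> \<gamma> (D_m H) (m_max H) (mu_min H))
            (C3 \<gamma> \<beta> (D_m H))"
    and xy: "x \<in> verts G" "y \<in> verts G"
    and t: "t \<ge> (real (diam G))\<^sup>2"
  shows "\<bar>heat_kernel G t x y - 1 / vol G (verts G)\<bar>
    \<le> 1 / vol G (verts G)
      * (C1 n \<epsilon> \<beta> \<gamma> (D_m G) (m_max G) (mu_min G)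
          * exp (C2 n \<epsilon> \<beta> \<gamma> (D_m G) (m_max G) (mu_min G) * sqrt (K * n) * real (diam G)) - 1)
      * exp (lam 2 * (real (diam G))\<^sup>2 - lam 2 * t)"
proof -
  interpret finite_weighted_graph G
    using graph finite(1) by (simp add: finite_weighted_graph_def finite_weighted_graph_axioms_def)
  let ?m = "vol G (verts G)"
  let ?D = "real (diam G)"
  let ?M = "C1 n \<epsilon> \<beta> \<gamma> (D_m G) (m_max G) (mu_min G)
      * exp (C2 n \<epsilon> \<beta> \<gamma> (D_m G) (m_max G) (mu_min G) * sqrt (K * n) * ?D)"
  \<comment> \<open>The assumed estimate is instantiated at \<open>G\<close> itself; subtracting the
    ground state turns \<open>?M\<close> into \<open>?M - 1\<close>.\<close>
  have diag: "heat_kernel G (?D\<^sup>2) z z - 1 / ?m \<le> 1 / ?m * (?M - 1)" if "z \<in> verts G" for z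
    using heat_kernel_diagonal_at_diam[OF eigenvalues(1) finite(2)
        estimate[OF graph curvature] that]
    by (simp add: right_diff_distrib diff_divide_distrib)
  have "\<bar>heat_kernel G t x y - 1 / ?m\<bar>
      \<le> ((heat_kernel G (?D\<^sup>2) x x - 1 / ?m) + (heat_kernel G (?D\<^sup>2) y y - 1 / ?m)) / 2
        * exp (lam 2 * ?D\<^sup>2 - lam 2 * t)"
    by (rule heat_kernel_convergence[OF eigenvalues xy t])
  also have "\<dots> \<le> 1 / ?m * (?M - 1) * exp (lam 2 * ?D\<^sup>2 - lam 2 * t)"
  proof (rule mult_right_mono)
    show "((heat_kernel G (?D\<^sup>2) x x - 1 / ?m) + (heat_kernel G (?D\<^sup>2) y y - 1 / ?m)) / 2
        \<le> 1 / ?m * (?M - 1)"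
      \<comment> \<open>Both diagonal terms obey the same bound, hence so does their mean.\<close>
      using add_mono[OF diag[OF xy(1)] diag[OF xy(2)]]
      by (subst pos_divide_le_eq) (simp_all only: mult_2_right zero_less_numeral)
  qed simp
  finally show ?thesis .
qed

end
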